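(* Let $n$ be a positive integer. Every $x \in V_{A_n}$ is the root of a reversed binary tree (in the graph of $\theta$ on $\mathbf{P}^1(\mathbf{F}_{5^n})$) of some depth $d$ with the following properties. - If $x \neq \infty$, then there are $2^{k-1}$ vertices at any level $k$ of the tree with $0 < k \le d$. Moreover, the root has one child, while all other vertices at levels smaller than $d$ have two children. - If $x = \infty$, then there is $1$ vertex at level $1$, there are $2$ vertices at level $2$, and there are $2^{k-2}$ vertices at any level $k$ with $2 < k \le d$. Moreover, the root and the vertices at level $2$ have one child each, while all other vertices at levels smaller than $d$ have two children. - If $n$ is odd, then $d = 2$ if $x \neq \infty$, and $d = 3$ if $x = \infty$. - If $n$ is even and $2^l$ is the greatest power of $2$ which divides $n$, then $d = 3 + 2l$.
   Context: Let $\mathbf{P}^1(\mathbf{F}_{5^n}) = \mathbf{F}_{5^n} \cup \{\infty\}$ and let $\theta(x) = x + x^{-1}$ for $x \neq 0,\infty$, $\theta(0)=\theta(\infty)=\infty$. The graph of $\theta$ has vertex set $\mathbf{P}^1(\mathbf{F}_{5^n})$ and a directed edge from $\alpha$ to $\theta(\alpha)$ for each $\alpha$. An element $\gamma$ is periodic (belongs to a cycle) if $\theta^k(\gamma)=\gamma$ for some positive integer $k$. Let $E$ be the elliptic curve $y^2=x^3+x$ over $\mathbf{F}_5$ and $A_n = \{x \in \mathbf{F}_{5^n} : (x,y)\in E(\mathbf{F}_{5^n}) \text{ for some } y \in \mathbf{F}_{5^n}\}\cup\{\infty\}$. The map $\theta$ sends $A_n$ to itself. $V_{A_n}$ denotes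 the set of elements of $\mathbf{P}^1(\mathbf{F}_{5^n})$ belonging to some cycle formed by elements of $A_n$ (in particular $\infty \in V_{A_n}$). For periodic $x$, the reversed tree rooted in $x$ has $x$ as its only vertex at level $0$; an element $\tilde x \in \mathbf{P}^1(\mathbf{F}_{5^n})$ is at level $k>0$ if $\theta^k(\tilde x)=x$ and none of $\theta^i(\tilde x)$ with $0\le i<k$ is periodic. The children of a vertex $z$ of the tree at level $k$ are the vertices $\tilde z$ at level $k+1$ with $\theta(\tilde z)=z$. The depth of the tree is the largest level that contains a vertex. *)

theory Defs
  imports "HOL-Computational_Algebra.Primes" "HOL-Library.Cardinality"
begin

text \<open>The field with \<open>5 ^ n\<close> elements is an arbitrary type \<open>'a :: {field, finite}\<close> with
  \<open>CARD('a) = 5 ^ n\<close>; such a field is unique up to isomorphism.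
  In its projective line, \<^term>\<open>None\<close> is the point at infinity.\<close>

type_synonym 'a proj_line = "'a option"

abbreviation infty :: "'a proj_line" where
  "infty \<equiv> None"

definition \<theta> :: "'a::field proj_line \<Rightarrow> 'a proj_line" where
  "\<theta> p = (case p of None \<Rightarrow> infty | Some x \<Rightarrow> if x = 0 then infty else Some (x + inverse x))"

definition periodic :: "'a::field proj_line \<Rightarrow> bool" where
  "periodic p \<longleftrightarrow> (\<exists>k>0. (\<theta> ^^ k) p = p)"

definition E_affine :: "('a::field \<times> 'a) set" where
  "E_affine = {(x, y). y ^ 2 = x ^ 3 + x}"

definition A_set :: "'a::field proj_line set" where
  "A_set = Some ` {x. \<exists>y. (x, y) \<in> E_affine} \<union> {infty}"

definition V_A :: "'a::field proj_line set" where
  "V_A = {p. \<exists>k>0. (\<theta> ^^ k) p = p \<and> (\<forall>i<k. (\<theta> ^^ i) p \<in> A_set)}"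

definition level :: "'a::field proj_line \<Rightarrow> nat \<Rightarrow> 'a proj_line set" where
  "level x k = (if k = 0 then {x}
     else {z. (\<theta> ^^ k) z = x \<and> (\<forall>i<k. \<not> periodic ((\<theta> ^^ i) z))})"

text \<open>The children of a vertex \<open>z\<close> lying at level \<open>k\<close> of the tree rooted in \<open>x\<close>.\<close>

definition children :: "'a::field proj_line \<Rightarrow> nat \<Rightarrow> 'a proj_line \<Rightarrow> 'a proj_line set" where
  "children x k z = {w \<in> level x (Suc k). \<theta> w = z}"

text \<open>A relation rather than a function, so that it asserts that a largest nonempty level exists.\<close>

definition has_depth :: "'a::field proj_line \<Rightarrow> nat \<Rightarrow> bool" where
  "has_depth x d \<longleftrightarrow> level x d \<noteq> {} \<and> (\<forall>k. level x k \<noteq> {} \<longrightarrow> k \<le> d)"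

text \<open>The levels form a rooted tree with edges directed towards the root: they are pairwise
  disjoint, and the successor under \<^term>\<open>\<theta>\<close> of a vertex at level \<open>k + 1\<close>, its unique parent,
  is at level \<open>k\<close>. Binary means that a vertex has at most two children.\<close>

definition reversed_binary_tree :: "'a::field proj_line \<Rightarrow> bool" where
  "reversed_binary_tree x \<longleftrightarrow>
     (\<forall>j k. j \<noteq> k \<longrightarrow> level x j \<inter> level x k = {}) \<and>
     (\<forall>k. \<forall>w \<in> level x (Suc k). \<theta> w \<in> level x k) \<and>
     (\<forall>k. \<forall>z \<in> level x k. finite (children x k z) \<and> card (children x k z) \<le> 2)"

end

theory Submission
  imports Defs "HOL-Computational_Algebra.Polynomial" "HOL-Computational_Algebra.Nth_Powers"
begin

text \<open>
  On the elliptic curve \<open>y\<^sup>2 = x\<^sup>3 + x\<close>, which has complex multiplication by the Gaussian integers,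
  the map \<^term>\<open>\<theta>\<close> is the action of \<open>1 + i\<close> on abscissas. The proof follows that picture, but with
  explicit formulas on the line only: neither the group law of the curve nor an extension of the
  field is constructed.

  A finite \<open>b\<close> has preimages under \<^term>\<open>\<theta>\<close> exactly if the discriminant \<open>b\<^sup>2 - 4 = b\<^sup>2 + 1\<close> is a
  square, and then it has two, unless \<open>b\<^sup>2 = -1\<close> (\<open>card_preimages_Some\<close>). Therefore the shape of a
  tree is determined by deciding, at each of its vertices, whether this discriminant is a square.
  Write \<open>n = 2\<^sup>l m\<close> with \<open>m\<close> odd.

  The tree rooted at infinity. Its levels 1, 2 and 3 are \<open>{0}\<close>, \<open>{2, -2}\<close> and \<open>{1, -1}\<close>. From level 3
  on, every two steps upwards double the degree of the field of definition: a vertex at level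
  \<open>3 + 2j\<close> lies in the field with \<open>Q = 5^(2^j)\<close> elements and its discriminant is a nonsquare there.
  Consequently its two preimages \<open>S\<close> and \<open>1/S\<close> are conjugate over that field, and computing norms
  shows that everything is a square at \<open>S\<close> but that the preimages of \<open>S\<close> are again obstructed, now
  over the field with \<open>Q\<^sup>2\<close> elements (\<open>obstructed_double\<close>). A nonsquare of a subfield becomes a square
  exactly in the extensions of even degree, so the tree stops at level \<open>3 + 2l\<close>
  (\<open>infty_tree_branching\<close>).

  The other trees. Let \<open>P\<close> be at level \<open>k > 0\<close> over \<open>x \<noteq> \<infinity>\<close>, and let \<open>p\<close> be the periodic point from
  which \<open>x\<close> is reached in \<open>k\<close> steps. With points of the curve chosen above \<open>P\<close> and \<open>p\<close>, one
  of their sum and difference is annihilated by \<open>(1 + i)\<^sup>k\<close> but by no lower power, so that its abscissa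
  \<open>t\<close> is at level \<open>k\<close> of the tree at infinity (\<open>chord_pullback\<close>). The product of the abscissas of
  three collinear points is a square, because it is the square of the constant term of the line.
  Since \<open>p\<close> is a square, being itself the image of a periodic point, \<open>P\<close> is a square if and only if
  \<open>t\<close> is (\<open>tree_square_transfer\<close>). On the curve \<open>P (P\<^sup>2 + 1)\<close> is a square, hence being a square
  is the condition for having preimages. So the tree at \<open>x\<close> branches as long as the vertices of the
  tree at infinity are squares; this lasts up to level \<open>3 + 2l\<close> if \<open>n\<close> is even and only up to level 2,
  where 2 and -2 are nonsquares, if \<open>n\<close> is odd (\<open>infty_tree_square_iff\<close>).
\<close>


section \<open>Squares in a finite field\<close>

lemma is_square_mult_iff:
  fixes x y :: "'a::field"
  assumes "is_square x" "x \<noteq> 0"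
  shows "is_square (x * y) \<longleftrightarrow> is_square y"
proof -
  obtain u where u: "x = u ^ 2" using assms(1) unfolding is_nth_power_def by blast
  show ?thesis
  proof
    assume "is_square (x * y)"
    then obtain v where "x * y = v ^ 2" unfolding is_nth_power_def by blast
    then have "y = (v / u) ^ 2" using u assms(2) by (simp add: field_simps)
    then show "is_square y" unfolding is_nth_power_def by blast
  next
    assume "is_square y"
    then obtain v where "y = v ^ 2" unfolding is_nth_power_def by blast
    then have "x * y = (u * v) ^ 2" using u by (simp add: power_mult_distrib)
    then show "is_square (x * y)" unfolding is_nth_power_def by blast
  qed
qed

lemma is_square_iff_of_mult:
  fixes x y :: "'a::field"
  assumes "is_square (x * y)" "x * y \<noteq> 0"
  shows "is_square x \<longleftrightarrow> is_square y"
proof -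
  have "is_square ((x * y) * y) \<longleftrightarrow> is_square y"
    by (rule is_square_mult_iff) (use assms in auto)
  moreover have "(x * y) * y = y ^ 2 * x" by (simp add: power2_eq_square)
  moreover have "is_square (y ^ 2 * x) \<longleftrightarrow> is_square x"
    by (rule is_square_mult_iff) (use assms in \<open>auto simp: is_nth_power_nth_power\<close>)
  ultimately show ?thesis by simp
qed

lemma finite_field_power_card_minus_1:
  fixes x :: "'a::{field,finite}"
  assumes "x \<noteq> 0"
  shows "x ^ (CARD('a) - 1) = 1"
proof -
  have "(\<Prod>y\<in>UNIV - {0::'a}. x * y) = \<Prod>(UNIV - {0})"
    by (rule prod.reindex_bij_witness[of _ "\<lambda>y. y / x" "\<lambda>y. x * y"]) (use assms in auto)
  moreover have "(\<Prod>y\<in>UNIV - {0::'a}. x * y) = x ^ (CARD('a) - 1) * \<Prod>(UNIV - {0})"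
    by (simp add: prod.distrib card_Diff_singleton)
  moreover have "\<Prod>(UNIV - {0::'a}) \<noteq> 0" by simp
  ultimately show ?thesis by simp
qed

text \<open>The nonzero squares are roots of \<open>X ^ ((q - 1) / 2) - 1\<close>; since squaring is at most
  two-to-one there are at least \<open>(q - 1) / 2\<close> of them, which exhausts the roots.\<close>

lemma euler_criterion:
  fixes x :: "'a::{field,finite}"
  assumes "odd (CARD('a))" "x \<noteq> 0"
  shows "is_square x \<longleftrightarrow> x ^ ((CARD('a) - 1) div 2) = 1"
proof -
  let ?h = "(CARD('a) - 1) div 2"
  let ?S = "(\<lambda>y::'a. y ^ 2) ` (UNIV - {0})"
  let ?p = "monom (1::'a) ?h - 1"
  have h2: "2 * ?h = CARD('a) - 1" using assms(1) by auto
  have "card {0, x} \<le> CARD('a)" by (rule card_mono) auto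
  then have "CARD('a) \<ge> 2" using assms(2) by simp
  then have hpos: "?h > 0" using assms(1) by presburger
  have coeff: "coeff ?p ?h = 1" using hpos by simp
  then have p0: "?p \<noteq> 0" by (metis coeff_0 zero_neq_one)
  have deg: "degree ?p \<le> ?h"
    by (rule degree_diff_le) (auto simp: degree_monom_le)
  have sub: "?S \<subseteq> {r. poly ?p r = 0}"
    using finite_field_power_card_minus_1[where 'a='a]
    by (auto simp: poly_monom h2 simp flip: power_mult simp del: One_nat_def)
  have "CARD('a) - 1 = card (UNIV - {0::'a})" by (simp add: card_Diff_singleton)
  also have "UNIV - {0::'a} = (\<Union>s\<in>?S. {y. y \<noteq> 0 \<and> y ^ 2 = s})" by auto
  also have "card \<dots> \<le> (\<Sum>s\<in>?S. card {y. y \<noteq> 0 \<and> y ^ 2 = s})"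
    by (rule card_UN_le) simp
  also have "\<dots> \<le> (\<Sum>s\<in>?S. 2)"
  proof (rule sum_mono)
    fix s assume "s \<in> ?S"
    then obtain u where "s = u ^ 2" by auto
    then have "{y. y \<noteq> 0 \<and> y ^ 2 = s} \<subseteq> {u, -u}" by (auto simp: power2_eq_iff)
    then have "card {y. y \<noteq> 0 \<and> y ^ 2 = s} \<le> card {u, -u}" by (rule card_mono[rotated]) simp
    also have "\<dots> \<le> 2" by (simp add: card_insert_if)
    finally show "card {y. y \<noteq> 0 \<and> y ^ 2 = s} \<le> 2" .
  qed
  finally have "?h \<le> card ?S" using h2 by simp
  moreover have "card {r. poly ?p r = 0} \<le> ?h"
    using card_poly_roots_bound[OF p0] deg by simp
  ultimately have "?S = {r. poly ?p r = 0}"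
    using sub card_mono[OF poly_roots_finite[OF p0] sub] poly_roots_finite[OF p0]
    by (intro card_subset_eq) linarith+
  then have "x \<in> ?S \<longleftrightarrow> poly ?p x = 0" by simp
  then show ?thesis using assms(2) by (auto simp: is_nth_power_def poly_monom)
qed

text \<open>Passing from the subfield with \<open>Q\<close> elements to one of relative degree \<open>r\<close> multiplies the
  Euler exponent by a number with the parity of \<open>r\<close>.\<close>

lemma power_minus_1_eq_mult:
  fixes Q :: nat
  assumes "odd Q"
  shows "\<exists>s. Q ^ r - 1 = (Q - 1) * s \<and> (even s \<longleftrightarrow> even r)"
proof (induction r)
  case 0
  show ?case by (rule exI[of _ 0]) simp
next
  case (Suc r)
  then obtain s where s: "Q ^ r - 1 = (Q - 1) * s" "even s \<longleftrightarrow> even r" by blast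
  obtain k where k: "Q = Suc k" using assms by (cases Q) auto
  have "Q ^ r \<ge> 1" using k by simp
  then have "Q ^ r = 1 + k * s" using s(1) k by (metis diff_Suc_1 le_add_diff_inverse)
  then have "Q ^ Suc r - 1 = (Q - 1) * (1 + s * Q)" using k by (simp add: algebra_simps)
  moreover have "even (1 + s * Q) \<longleftrightarrow> even (Suc r)" using s(2) assms by auto
  ultimately show ?case by blast
qed

lemma power_half_tower:
  fixes x :: "'a::{field,finite}"
  assumes "odd Q" "CARD('a) = Q ^ r"
  obtains s where "x ^ ((CARD('a) - 1) div 2) = (x ^ ((Q - 1) div 2)) ^ s" "even s \<longleftrightarrow> even r"
proof -
  obtain s where s: "Q ^ r - 1 = (Q - 1) * s" "even s \<longleftrightarrow> even r"
    using power_minus_1_eq_mult[OF assms(1)] by blast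
  have "even (Q - 1)" using assms(1) by simp
  then have "(Q ^ r - 1) div 2 = ((Q - 1) div 2) * s" using s(1) by (simp add: div_mult_swap mult.commute)
  then show thesis using that s(2) assms(2) by (simp add: power_mult)
qed

lemma is_square_if_power_half_1:
  fixes x :: "'a::{field,finite}"
  assumes "odd Q" "CARD('a) = Q ^ r" "x \<noteq> 0" "x ^ ((Q - 1) div 2) = 1"
  shows "is_square x"
proof -
  obtain s where "x ^ ((CARD('a) - 1) div 2) = (x ^ ((Q - 1) div 2)) ^ s"
    using power_half_tower[OF assms(1,2)] by blast
  moreover have "odd (CARD('a))" using assms by simp
  ultimately show ?thesis using euler_criterion[OF _ assms(3)] assms(4) by simp
qed

lemma is_square_iff_even_degree:
  fixes x :: "'a::{field,finite}"
  assumes "odd Q" "CARD('a) = Q ^ r" "x \<noteq> 0" "x ^ ((Q - 1) div 2) = -1" "(2::'a) \<noteq> 0"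
  shows "is_square x \<longleftrightarrow> even r"
proof -
  obtain s where s: "x ^ ((CARD('a) - 1) div 2) = (x ^ ((Q - 1) div 2)) ^ s" "even s \<longleftrightarrow> even r"
    using power_half_tower[OF assms(1,2)] by blast
  have ne: "(-1::'a) \<noteq> 1" using assms(5) by (metis add.right_inverse one_add_one)
  have "odd (CARD('a))" using assms by simp
  then have "is_square x \<longleftrightarrow> (-1::'a) ^ s = 1"
    using euler_criterion[OF _ assms(3)] s(1) assms(4) by simp
  also have "\<dots> \<longleftrightarrow> even s" using ne by (cases "even s") auto
  finally show ?thesis using s(2) by simp
qed

section \<open>Characteristic five\<close>

lemma five_eq_0:
  assumes "CHAR('a::field) = 5"
  shows "(5::'a) = 0"
  using of_nat_CHAR[where 'a='a] assms by simp

lemma two_neq_0: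
  assumes "CHAR('a::field) = 5"
  shows "(2::'a) \<noteq> 0"
proof
  assume "(2::'a) = 0"
  then have "of_nat 2 = (0::'a)" by simp
  then show False using assms by (simp only: of_nat_eq_0_iff_char_dvd) simp
qed

lemma CHAR_eq_5:
  assumes "n > 0" "CARD('a::{field,finite}) = 5 ^ n"
  shows "CHAR('a) = 5"
proof -
  have "(\<Sum>y\<in>UNIV. y + (1::'a)) = \<Sum>UNIV"
    by (rule sum.reindex_bij_witness[of _ "\<lambda>y. y - 1" "\<lambda>y. y + 1"]) auto
  then have "of_nat (5 ^ n) = (0::'a)" using assms(2) by (simp add: sum.distrib)
  then have "CHAR('a) dvd 5 ^ n" by (simp only: of_nat_eq_0_iff_char_dvd)
  moreover have "prime CHAR('a)"
    by (intro prime_CHAR_semidom finite_imp_CHAR_pos) simp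
  ultimately have "CHAR('a) dvd 5" using prime_dvd_power by blast
  moreover have "prime (5::nat)" by simp
  ultimately show ?thesis using \<open>prime CHAR('a)\<close> primes_dvd_imp_eq by blast
qed

lemma frobenius_add:
  assumes "CHAR('a::field) = 5"
  shows "(x + y :: 'a) ^ (5 ^ e) = x ^ (5 ^ e) + y ^ (5 ^ e)"
  by (rule freshmans_dream') (use assms in auto)

lemma frobenius_2:
  assumes "CHAR('a::field) = 5"
  shows "(2::'a) ^ (5 ^ e) = 2"
  using frobenius_add[OF assms, of 1 1 e] by simp

section \<open>Doubling the degree of the field of definition\<close>

lemma odd_power_5:
  fixes Q :: nat
  assumes "Q = 5 ^ e" "e > 0"
  shows "odd Q" "Q > 1"
  using assms one_less_power[of "5::nat" e] by auto

lemma power_odd_eq_half: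
  fixes x :: "'a::field"
  assumes "odd Q" "Q > 1"
  shows "x ^ Q = x * (x ^ 2) ^ ((Q - 1) div 2)"
proof -
  have "Q = Suc (2 * ((Q - 1) div 2))" using assms by auto
  then show ?thesis by (metis power_Suc power_mult)
qed

lemma half_power_square:
  fixes Q :: nat
  assumes "odd Q"
  shows "(Q ^ 2 - 1) div 2 = (Q + 1) * ((Q - 1) div 2)"
proof -
  obtain k where "Q = 2 * k + 1" using assms by (elim oddE)
  then show ?thesis by (simp add: power2_eq_square algebra_simps)
qed

text \<open>The square root \<open>S - 1/S\<close> of the discriminant changes sign under the Frobenius map of the field
  with \<open>Q\<close> elements, so that map exchanges the two roots \<open>S\<close> and \<open>1/S\<close> of \<open>X\<^sup>2 - T X + 1\<close>.\<close>

lemma conjugate_preimage: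
  fixes S T :: "'a::field"
  assumes c: "CHAR('a) = 5" and Q: "Q = 5 ^ e" "e > 0"
    and T: "T ^ Q = T" "(T ^ 2 + 1) ^ ((Q - 1) div 2) = -1"
    and S: "S \<noteq> 0" "S + inverse S = T"
  shows "S ^ Q = inverse S"
proof -
  have Qo: "odd Q" "Q > 1" using odd_power_5[OF Q] by auto
  define \<delta> where "\<delta> = S - inverse S"
  have "\<delta> ^ 2 = T ^ 2 + 1 - 5"
    unfolding \<delta>_def S(2)[symmetric] using S(1) by (simp add: field_simps power2_eq_square)
  then have "\<delta> ^ 2 = T ^ 2 + 1" using five_eq_0[OF c] by simp
  then have "\<delta> ^ Q = - \<delta>" using power_odd_eq_half[OF Qo, of \<delta>] T(2) by simp
  moreover have "(T + \<delta>) ^ Q = T ^ Q + \<delta> ^ Q" unfolding Q(1) by (rule frobenius_add[OF c])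
  ultimately have "(T + \<delta>) ^ Q = T - \<delta>" using T(1) by simp
  moreover have "T + \<delta> = 2 * S" "T - \<delta> = 2 * inverse S" unfolding \<delta>_def S(2)[symmetric] by auto
  ultimately have "2 ^ Q * S ^ Q = 2 * inverse S" by (simp add: power_mult_distrib)
  then show ?thesis using frobenius_2[OF c, of e] Q(1) two_neq_0[OF c] by simp
qed

text \<open>An element of the field with \<open>Q\<^sup>2\<close> elements is a square there if its norm is a square in the field
  with \<open>Q\<close> elements. The norm of \<open>S\<close> is 1, and that of \<open>S\<^sup>2 + 1\<close> is
  \<open>(S\<^sup>2 + 1) (S\<^sup>-\<^sup>2 + 1) = (S + 1/S)\<^sup>2 = T\<^sup>2\<close>.\<close>

lemma discriminant_of_preimage:
  fixes S T :: "'a::field"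
  assumes c: "CHAR('a) = 5" and Q: "Q = 5 ^ e" "e > 0"
    and T: "T ^ Q = T" "(T ^ 2 + 1) ^ ((Q - 1) div 2) = -1" "T \<noteq> 0"
    and S: "S \<noteq> 0" "S + inverse S = T"
  shows "(S ^ 2 + 1) ^ ((Q ^ 2 - 1) div 2) = 1" "S ^ ((Q ^ 2 - 1) div 2) = 1"
proof -
  have Qo: "odd Q" "Q > 1" using odd_power_5[OF Q] by auto
  have SQ: "S ^ Q = inverse S" by (rule conjugate_preimage[OF c Q T(1,2) S])
  show "S ^ ((Q ^ 2 - 1) div 2) = 1"
    unfolding half_power_square[OF Qo(1)] power_mult using SQ S(1) by simp
  have TQ: "(T ^ 2) ^ ((Q - 1) div 2) = 1"
    using power_odd_eq_half[OF Qo, of T] T(1,3) by simp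
  have "(S ^ 2 + 1) ^ Q = (S ^ 2) ^ Q + 1 ^ Q" unfolding Q(1) by (rule frobenius_add[OF c])
  also have "(S ^ 2) ^ Q = (S ^ Q) ^ 2" by (simp add: mult.commute flip: power_mult)
  finally have "(S ^ 2 + 1) ^ (Q + 1) = (S ^ 2 + 1) * (inverse S ^ 2 + 1)"
    using SQ by simp
  also have "\<dots> = (S + inverse S) ^ 2" using S(1) by (simp add: field_simps power2_eq_square)
  finally show "(S ^ 2 + 1) ^ ((Q ^ 2 - 1) div 2) = 1"
    unfolding half_power_square[OF Qo(1)] power_mult using TQ S(2) by simp
qed

text \<open>The Euler conditions say that \<open>2 T\<close> and \<open>T\<^sup>2 + 1\<close> are nonsquares in the field with \<open>Q\<close> elements; the
  second one is the obstruction to preimages of \<open>T\<close> in that field. The factor 2 is a square as soon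
  as \<open>Q\<close> is a power of 25; it is there so that the condition also holds at \<open>T = 1\<close> and
  \<open>T = -1\<close> for \<open>Q = 5\<close>, where the induction over the levels starts.\<close>

definition obstructed :: "nat \<Rightarrow> 'a::field \<Rightarrow> bool" where
  "obstructed Q T \<longleftrightarrow> T \<noteq> 0 \<and> T ^ Q = T \<and>
     (2 * T) ^ ((Q - 1) div 2) = -1 \<and> (T ^ 2 + 1) ^ ((Q - 1) div 2) = -1"

text \<open>Let \<open>V\<close> be the conjugate of \<open>W\<close> over the field with \<open>Q\<close> elements and \<open>N = W V\<close> its norm. Since
  \<open>(W + 1/W) (V + 1/V) = S (1/S) = 1\<close>, one finds \<open>(W + V)\<^sup>2 = 5 N - (N + 1)\<^sup>2 = -(N + 1)\<^sup>2\<close>, while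
  \<open>T N = (W + V) (N + 1)\<close>. As -1 is the square of 2, \<open>2 T N\<close> equals \<open>(N + 1)\<^sup>2\<close> up to sign and
  is a square, so the norm \<open>N\<close> is a nonsquare together with \<open>2 T\<close>, and hence so is \<open>W\<close>. Finally
  \<open>W\<^sup>2 + 1 = W S\<close> with \<open>S\<close> a square.\<close>

lemma obstructed_double:
  fixes S T W :: "'a::field"
  assumes c: "CHAR('a) = 5" and Q: "Q = 5 ^ e" "e > 0"
    and T: "obstructed Q T"
    and S: "S \<noteq> 0" "S + inverse S = T"
    and W: "W \<noteq> 0" "W + inverse W = S"
  shows "obstructed (Q ^ 2) W"
proof -
  have Qo: "odd Q" "Q > 1" using odd_power_5[OF Q] by auto
  have Qo2: "odd (Q ^ 2)" "Q ^ 2 > 1" using Qo one_less_power[of Q 2] by auto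
  note f5 = five_eq_0[OF c]
  have T': "T ^ Q = T" "(T ^ 2 + 1) ^ ((Q - 1) div 2) = -1" "T \<noteq> 0"
    "(2 * T) ^ ((Q - 1) div 2) = -1" using T unfolding obstructed_def by auto
  have SQ: "S ^ Q = inverse S" by (rule conjugate_preimage[OF c Q T'(1,2) S])
  note disc = discriminant_of_preimage[OF c Q T'(1,2,3) S]
  have e2: "Q ^ 2 = 5 ^ (e * 2)" by (simp add: Q(1) power_mult)
  have SQ2: "S ^ (Q ^ 2) = S"
    unfolding power2_eq_square power_mult SQ by (simp add: power_inverse SQ)
  have WQ2: "W ^ (Q ^ 2) = W"
  proof -
    define \<delta> where "\<delta> = W - inverse W"
    have "\<delta> ^ 2 = S ^ 2 + 1 - 5"
      unfolding \<delta>_def W(2)[symmetric] using W(1) by (simp add: field_simps power2_eq_square)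
    then have "\<delta> ^ 2 = S ^ 2 + 1" using f5 by simp
    then have "\<delta> ^ (Q ^ 2) = \<delta>" using power_odd_eq_half[OF Qo2, of \<delta>] disc(1) by simp
    moreover have "(S + \<delta>) ^ (Q ^ 2) = S ^ (Q ^ 2) + \<delta> ^ (Q ^ 2)"
      unfolding e2 by (rule frobenius_add[OF c])
    ultimately have "(S + \<delta>) ^ (Q ^ 2) = S + \<delta>" using SQ2 by simp
    moreover have "S + \<delta> = 2 * W" unfolding \<delta>_def W(2)[symmetric] by simp
    ultimately have "2 ^ (Q ^ 2) * W ^ (Q ^ 2) = 2 * W" by (simp add: power_mult_distrib)
    then show ?thesis using frobenius_2[OF c, of "e * 2"] e2 two_neq_0[OF c] by simp
  qed
  define V where "V = W ^ Q"
  define N where "N = W * V"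
  have V0: "V \<noteq> 0" using W(1) V_def by simp
  have N0: "N \<noteq> 0" using W(1) V0 N_def by simp
  have VS: "V + inverse V = inverse S"
  proof -
    have "(W + inverse W) ^ Q = W ^ Q + inverse W ^ Q" unfolding Q(1) by (rule frobenius_add[OF c])
    then show ?thesis using W(2) SQ by (simp add: V_def power_inverse)
  qed
  have NQ: "N ^ Q = N"
    unfolding N_def power_mult_distrib V_def
    using WQ2 by (simp add: mult.commute power2_eq_square flip: power_mult)
  have TN: "T * N = (W + V) * (N + 1)"
  proof -
    have "T = (W + inverse W) + (V + inverse V)" using S(2) VS W(2) by simp
    moreover have "((W + inverse W) + (V + inverse V)) * (W * V) = (W + V) * (W * V + 1)"
      using W(1) V0 by (simp add: field_simps)
    ultimately show ?thesis unfolding N_def by (simp only:)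
  qed
  have "(W + inverse W) * (V + inverse V) = 1" using W(2) VS S(1) by simp
  then have "(W ^ 2 + 1) * (V ^ 2 + 1) = N"
    using W(1) V0 unfolding N_def by (simp add: field_simps power2_eq_square)
  then have "(W + V) ^ 2 = 5 * N - (N + 1) ^ 2"
    unfolding N_def by (simp add: algebra_simps power2_eq_square)
  then have "(W + V) ^ 2 = 5 * (N + 1) ^ 2 - (N + 1) ^ 2" using f5 by simp
  then have "(W + V) ^ 2 = (2 * (N + 1)) ^ 2" by (simp add: algebra_simps power2_eq_square)
  then have WV: "W + V = 2 * (N + 1) \<or> W + V = - (2 * (N + 1))" by (simp only: power2_eq_iff)
  have N1: "N + 1 \<noteq> 0" using TN T'(3) N0 by auto
  have "(N + 1) ^ Q = N ^ Q + 1 ^ Q" unfolding Q(1) by (rule frobenius_add[OF c])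
  then have "(N + 1) ^ Q = N + 1" using NQ by simp
  then have N1h: "((N + 1) ^ 2) ^ ((Q - 1) div 2) = 1"
    using power_odd_eq_half[OF Qo, of "N + 1"] N1 by simp
  \<comment> \<open>-1 is a square in every field with \<open>Q\<close> elements, since \<open>Q\<close> is 1 modulo 4.\<close>
  have m1: "(-1 :: 'a) ^ ((Q - 1) div 2) = 1"
  proof -
    have "(5 mod 4) ^ e mod 4 = 5 ^ e mod (4::nat)" by (rule power_mod)
    then have "5 ^ e mod 4 = (1::nat)" by simp
    then obtain i where "(5::nat) ^ e = 4 * i + 1" using div_mult_mod_eq[of "5 ^ e" "4::nat"] by (metis mult.commute)
    then show ?thesis using Q(1) by simp
  qed
  have m4: "(2::'a) * 2 = -1" using f5 by (simp add: eq_neg_iff_add_eq_0)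
  have "2 * (T * N) = (2 * 2) * (N + 1) ^ 2 \<or> 2 * (T * N) = - (2 * 2) * (N + 1) ^ 2"
    unfolding TN using WV by (elim disjE) (simp_all only: power2_eq_square mult.assoc mult_minus_left mult_minus_right simp_thms)
  then have "2 * T * N = (N + 1) ^ 2 * (-1) \<or> 2 * T * N = (N + 1) ^ 2"
    unfolding m4 by (auto simp: mult.assoc)
  then have "(2 * T * N) ^ ((Q - 1) div 2) = 1"
    by (elim disjE) (simp_all only: power_mult_distrib[of _ "-1"] N1h m1 mult_1_right)
  then have Nh: "N ^ ((Q - 1) div 2) = -1" using T'(4)
    by (simp add: power_mult_distrib minus_equation_iff[of _ 1] eq_commute[of "-1"])
  have WQ1: "W ^ (Q + 1) = N" by (simp add: N_def V_def)
  have Wh: "W ^ ((Q ^ 2 - 1) div 2) = -1"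
    unfolding half_power_square[OF Qo(1)] power_mult WQ1 using Nh by simp
  have "2 * (2 ^ Q) = (2::'a) * 2" using frobenius_2[OF c, of e] Q(1) by simp
  then have "(2::'a) ^ (Q + 1) = -1" using m4 by simp
  then have h2: "(2::'a) ^ ((Q ^ 2 - 1) div 2) = 1"
    unfolding half_power_square[OF Qo(1)] power_mult using m1 by simp
  have "W ^ 2 + 1 = W * S" using W by (simp add: field_simps power2_eq_square)
  then have "(W ^ 2 + 1) ^ ((Q ^ 2 - 1) div 2) = -1" using Wh disc(2) by (simp add: power_mult_distrib)
  then show ?thesis unfolding obstructed_def using W(1) WQ2 Wh h2 by (simp add: power_mult_distrib)
qed



section \<open>Preimages and levels\<close>

lemma theta_None [simp]: "\<theta> None = None"
  by (simp add: \<theta>_def)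

lemma theta_zero [simp]: "\<theta> (Some 0) = None"
  by (simp add: \<theta>_def)

lemma theta_Some [simp]: "u \<noteq> 0 \<Longrightarrow> \<theta> (Some u) = Some (u + inverse u)"
  by (simp add: \<theta>_def)

lemma theta_eq_None_iff: "\<theta> p = None \<longleftrightarrow> p = None \<or> p = Some 0"
  by (cases p) (auto simp: \<theta>_def)

lemma theta_pow_None [simp]: "(\<theta> ^^ k) None = None"
  by (induction k) auto

lemma theta_pow_None_mono:
  assumes "(\<theta> ^^ k) p = None" "k \<le> m"
  shows "(\<theta> ^^ m) p = None"
proof -
  have "(\<theta> ^^ m) p = (\<theta> ^^ (m - k + k)) p" using assms(2) by simp
  also have "\<dots> = None" unfolding funpow_add using assms(1) by simp
  finally show ?thesis .
qed

lemma theta_pow_Suc: "(\<theta> ^^ Suc k) p = (\<theta> ^^ k) (\<theta> p)"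
  by (simp add: funpow_swap1)

lemma theta_pow_period:
  assumes "(\<theta> ^^ t) p = p"
  shows "(\<theta> ^^ (k * t)) p = p"
  using funpow_mod_eq[OF assms, of "k * t"] by simp

lemma periodic_theta_pow:
  assumes "periodic p"
  shows "periodic ((\<theta> ^^ i) p)"
proof -
  obtain t where t: "t > 0" "(\<theta> ^^ t) p = p" using assms unfolding periodic_def by blast
  have "(\<theta> ^^ t) ((\<theta> ^^ i) p) = (\<theta> ^^ (i + t)) p" by (metis add.commute comp_apply funpow_add)
  also have "\<dots> = (\<theta> ^^ i) p" unfolding funpow_add using t(2) by simp
  finally show ?thesis using t(1) unfolding periodic_def by blast
qed

lemma periodic_None [simp]: "periodic None"
  unfolding periodic_def by (rule exI[of _ 1]) simp

text \<open>Infinity is a fixed point, so no other cycle can reach it.\<close>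

lemma periodic_reaching_None:
  assumes "periodic p" "(\<theta> ^^ m) p = None"
  shows "p = None"
proof -
  obtain t where t: "t > 0" "(\<theta> ^^ t) p = p" using assms(1) unfolding periodic_def by blast
  have "m \<le> m * t" using t(1) by simp
  then have "(\<theta> ^^ (m * t)) p = None" by (rule theta_pow_None_mono[OF assms(2)])
  then show ?thesis using theta_pow_period[OF t(2)] by metis
qed

lemma theta_inj_periodic:
  assumes "periodic p" "periodic p'" "\<theta> p = \<theta> p'"
  shows "p = p'"
proof -
  obtain t where t: "t > 0" "(\<theta> ^^ t) p = p" using assms(1) unfolding periodic_def by blast
  obtain s where s: "s > 0" "(\<theta> ^^ s) p' = p'" using assms(2) unfolding periodic_def by blast
  obtain k where k: "s * t = Suc k" using s(1) t(1) by (metis gr0_implies_Suc nat_0_less_mult_iff)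
  have "p = (\<theta> ^^ (s * t)) p" using theta_pow_period[OF t(2)] by simp
  also have "\<dots> = (\<theta> ^^ (t * s)) p'"
    unfolding mult.commute[of t s] k theta_pow_Suc assms(3) ..
  also have "\<dots> = p'" by (rule theta_pow_period[OF s(2)])
  finally show ?thesis .
qed

lemma preimages_None: "{w. \<theta> w = None} = {None, Some 0}"
  by (auto simp: theta_eq_None_iff)

text \<open>Completing the square in \<open>u\<^sup>2 - b u + 1\<close>; its discriminant \<open>b\<^sup>2 - 4\<close> is \<open>b\<^sup>2 + 1\<close> here.\<close>

lemma preimages_Some_iff:
  fixes b u :: "'a::field"
  assumes c: "CHAR('a) = 5"
  shows "\<theta> (Some u) = Some b \<longleftrightarrow> (2 * u - b) ^ 2 = b ^ 2 + 1"
proof -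
  have m4: "(4::'a) = -1" using five_eq_0[OF c] by (simp add: eq_neg_iff_add_eq_0)
  have "(2 * u - b) ^ 2 = 4 * (u ^ 2 - b * u + 1) + (b ^ 2 + 1) - 5"
    by (simp add: power2_eq_square algebra_simps)
  also have "\<dots> = (b ^ 2 + 1) - (u ^ 2 - b * u + 1)" using five_eq_0[OF c] m4 by simp
  finally have "(2 * u - b) ^ 2 = b ^ 2 + 1 \<longleftrightarrow> u ^ 2 - b * u + 1 = 0"
    by (simp only: diff_eq_eq add_cancel_left_right add_cancel_right_right)
  also have "\<dots> \<longleftrightarrow> \<theta> (Some u) = Some b"
    by (cases "u = 0") (auto simp: field_simps power2_eq_square)
  finally show ?thesis ..
qed

lemma card_preimages_Some:
  fixes b :: "'a::field"
  assumes c: "CHAR('a) = 5"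
  shows "card {w. \<theta> w = Some b} =
    (if b ^ 2 + 1 = 0 then 1 else if is_square (b ^ 2 + 1) then 2 else 0)"
proof (cases "is_square (b ^ 2 + 1)")
  case True
  note t = two_neq_0[OF c]
  obtain y where y: "b ^ 2 + 1 = y ^ 2" using True unfolding is_nth_power_def by blast
  have "{w. \<theta> w = Some b} = Some ` {u. (2 * u - b) ^ 2 = y ^ 2}"
  proof (rule set_eqI)
    fix w show "w \<in> {w. \<theta> w = Some b} \<longleftrightarrow> w \<in> Some ` {u. (2 * u - b) ^ 2 = y ^ 2}"
      using preimages_Some_iff[OF c, of _ b] y by (cases w) (simp_all add: image_iff)
  qed
  also have "{u. (2 * u - b) ^ 2 = y ^ 2} = {(b + y) / 2, (b - y) / 2}"
    using t by (auto simp: power2_eq_iff field_simps)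
  finally have "card {w. \<theta> w = Some b} = card {(b + y) / 2, (b - y) / 2}"
    by (simp only: card_image[OF inj_Some])
  moreover have "(b + y) / 2 = (b - y) / 2 \<longleftrightarrow> y = 0"
  proof -
    have "(b + y) / 2 - (b - y) / 2 = y" using t by (simp add: diff_divide_distrib add_divide_distrib)
    then show ?thesis by (metis right_minus_eq)
  qed
  ultimately show ?thesis using True y by (cases "y = 0") auto
next
  case False
  have "w \<notin> {w. \<theta> w = Some b}" for w
    using preimages_Some_iff[OF c, of _ b] False
    by (cases w) (auto simp: is_nth_power_def simp del: theta_Some dest: sym)
  then have "{w. \<theta> w = Some b} = {}" by blast
  moreover have "b ^ 2 + 1 \<noteq> 0" using False is_nth_power_nth_power[of 2 0] by auto
  ultimately show ?thesis using False by simp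
qed

lemma not_periodic_level:
  assumes "z \<in> level x k" "i < k"
  shows "\<not> periodic ((\<theta> ^^ i) z)"
  using assms unfolding level_def by (auto split: if_splits)

lemma level_root_pow:
  assumes "z \<in> level x k"
  shows "(\<theta> ^^ k) z = x"
  using assms unfolding level_def by (auto split: if_splits)

text \<open>A preimage of a nonperiodic vertex is never periodic. At the root this fails, which is why the root
  loses one child.\<close>

lemma children_eq:
  assumes "z \<in> level x k" "k > 0"
  shows "children x k z = {w. \<theta> w = z}"
proof -
  have "w \<in> level x (Suc k)" if w: "\<theta> w = z" for w
  proof -
    have "\<not> periodic ((\<theta> ^^ i) w)" if "i < Suc k" for i
    proof (cases i)
      case 0
      have "\<not> periodic z" using not_periodic_level[OF assms(1), of 0] assms(2) by simp
      then show ?thesis using periodic_theta_pow[of w 1] w 0 by auto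
    next
      case (Suc j)
      then show ?thesis
        using not_periodic_level[OF assms(1), of j] that w by (simp add: theta_pow_Suc del: funpow.simps)
    qed
    moreover have "(\<theta> ^^ Suc k) w = x"
      using level_root_pow[OF assms(1)] w by (simp add: theta_pow_Suc del: funpow.simps)
    ultimately show ?thesis by (simp add: level_def)
  qed
  then show ?thesis unfolding children_def by blast
qed

lemma children_root: "children x 0 x = {w. \<theta> w = x \<and> \<not> periodic w}"
  unfolding children_def level_def by auto

lemma theta_level:
  assumes "w \<in> level x (Suc k)"
  shows "\<theta> w \<in> level x k"
proof -
  have "(\<theta> ^^ k) (\<theta> w) = x"
    using level_root_pow[OF assms] by (simp only: theta_pow_Suc)
  moreover have "\<not> periodic ((\<theta> ^^ i) (\<theta> w))" if "i < k" for i
    using not_periodic_level[OF assms, of "Suc i"] that by (simp only: theta_pow_Suc) simp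
  ultimately show ?thesis by (cases "k = 0") (auto simp: level_def)
qed

lemma reversed_binary_tree_periodic:
  fixes x :: "'a::{field,finite} proj_line"
  assumes c: "CHAR('a) = 5" and x: "periodic x"
  shows "reversed_binary_tree x"
  unfolding reversed_binary_tree_def
proof (intro conjI allI impI ballI)
  have "level x j \<inter> level x k = {}" if "j < k" for j k
    using level_root_pow[of _ x j] not_periodic_level[of _ x k j] that x by blast
  then show "level x j \<inter> level x k = {}" if "j \<noteq> k" for j k
    using that by (metis Int_commute nat_neq_iff)
  show "\<theta> w \<in> level x k" if "w \<in> level x (Suc k)" for k w
    by (rule theta_level[OF that])
  fix k z assume "z \<in> level x k"
  show "finite (children x k z)" by simp
  have "children x k z \<subseteq> {w. \<theta> w = z}" unfolding children_def by blast
  then have "card (children x k z) \<le> card {w. \<theta> w = z}" by (intro card_mono) simp_all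
  also have "\<dots> \<le> 2"
    by (cases z) (simp_all add: preimages_None card_preimages_Some[OF c])
  finally show "card (children x k z) \<le> 2" .
qed

lemma card_level_Suc:
  fixes x :: "'a::{field,finite} proj_line"
  assumes "\<And>z. z \<in> level x k \<Longrightarrow> card (children x k z) = m"
  shows "card (level x (Suc k)) = m * card (level x k)"
proof -
  have "level x (Suc k) = (\<Union>z\<in>level x k. children x k z)"
    using theta_level unfolding children_def by blast
  also have "card \<dots> = (\<Sum>z\<in>level x k. card (children x k z))"
    by (rule card_UN_disjoint) (auto simp: children_def)
  also have "\<dots> = m * card (level x k)" using assms by simp
  finally show ?thesis .
qed

lemma has_depthI:
  assumes "level x d \<noteq> {}" "\<And>z. z \<in> level x d \<Longrightarrow> children x d z = {}"
  shows "has_depth x d"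
proof -
  have "level x (Suc (d + k)) = {}" for k
  proof (induction k)
    case 0
    then show ?case using assms(2) theta_level unfolding children_def by fastforce
  next
    case (Suc k)
    then show ?case using theta_level by fastforce
  qed
  then have "level x k = {}" if "k > d" for k
    using that by (metis add_Suc_right less_imp_add_positive gr0_implies_Suc)
  then show ?thesis using assms(1) unfolding has_depth_def by (meson not_le)
qed

section \<open>The tree rooted at infinity\<close>

text \<open>Only infinity and 0 map to infinity, so every path that leads to infinity from elsewhere
  ends with a step from 0, and nothing on that path can be periodic.\<close>

lemma level_infty:
  "level None (Suc k) = {p. (\<theta> ^^ k) p = Some 0}"
proof (intro set_eqI iffI)
  fix p assume p: "p \<in> level None (Suc k)"
  then have "\<theta> ((\<theta> ^^ k) p) = None" using level_root_pow[OF p] by simp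
  moreover have "(\<theta> ^^ k) p \<noteq> None" using not_periodic_level[OF p, of k] by (metis lessI periodic_None)
  ultimately show "p \<in> {p. (\<theta> ^^ k) p = Some 0}" by (simp add: theta_eq_None_iff)
next
  fix p assume "p \<in> {p. (\<theta> ^^ k) p = Some 0}"
  then have p: "(\<theta> ^^ k) p = Some 0" by simp
  then have N: "(\<theta> ^^ Suc k) p = None" by simp
  have "\<not> periodic ((\<theta> ^^ i) p)" if "i < Suc k" for i
  proof
    assume "periodic ((\<theta> ^^ i) p)"
    moreover have "(\<theta> ^^ Suc k) ((\<theta> ^^ i) p) = None"
      using theta_pow_None_mono[OF N, of "Suc k + i"] by (simp only: funpow_add comp_apply)
    ultimately have "(\<theta> ^^ i) p = None" by (rule periodic_reaching_None)
    then have "(\<theta> ^^ k) p = None" using theta_pow_None_mono[of i p k] that by simp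
    then show False using p by simp
  qed
  then show "p \<in> level None (Suc k)" using N by (simp add: level_def)
qed

lemma nonzero_if_theta_pow2_finite:
  assumes "(\<theta> ^^ 2) (Some b) \<noteq> None"
  shows "b \<noteq> 0" "b ^ 2 + 1 \<noteq> 0"
proof -
  show b0: "b \<noteq> 0" using assms by (auto simp: numeral_2_eq_2)
  show "b ^ 2 + 1 \<noteq> 0"
  proof
    assume "b ^ 2 + 1 = 0"
    then have "b + inverse b = 0" using b0 by (simp add: field_simps power2_eq_square)
    then show False using assms b0 by (simp add: numeral_2_eq_2)
  qed
qed

lemma theta_pow_Suc_SomeE:
  assumes "(\<theta> ^^ Suc k) (Some u) = Some b"
  obtains "u \<noteq> 0" "(\<theta> ^^ k) (Some (u + inverse u)) = Some b"
  using assms by (cases "u = 0") (simp_all add: theta_pow_Suc del: funpow.simps)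

lemma theta_eq_zero_iff: "\<theta> (Some u) = Some 0 \<longleftrightarrow> u ^ 2 = -1"
  by (cases "u = 0") (auto simp: field_simps power2_eq_square eq_neg_iff_add_eq_0)

lemma theta_eq_zero_values:
  assumes c: "CHAR('a::field) = 5" and "\<theta> (Some u) = Some (0::'a)"
  shows "u = 2 \<or> u = -2"
proof -
  have "u ^ 2 = 2 ^ 2 - 5" using assms(2) by (simp add: theta_eq_zero_iff)
  then have "u ^ 2 = 2 ^ 2" using five_eq_0[OF c] by simp
  then show ?thesis by (simp only: power2_eq_iff)
qed

lemma theta_pow2_eq_zero:
  assumes c: "CHAR('a::field) = 5" and "(\<theta> ^^ 2) (Some u) = Some (0::'a)"
  shows "u = 1 \<or> u = -1"
proof -
  have "(\<theta> ^^ Suc 1) (Some u) = Some 0" using assms(2) by (simp only: numeral_2_eq_2 One_nat_def)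
  then obtain u0: "u \<noteq> 0" "(\<theta> ^^ 1) (Some (u + inverse u)) = Some 0"
    by (rule theta_pow_Suc_SomeE)
  then have "u + inverse u = 2 \<or> u + inverse u = -2" using theta_eq_zero_values[OF c] by simp
  moreover have "u * (u + inverse u) = u ^ 2 + 1" using u0(1) by (simp add: field_simps power2_eq_square)
  ultimately have "u ^ 2 + 1 = u * 2 \<or> u ^ 2 + 1 = u * (-2)" by metis
  moreover have "(u - 1) ^ 2 = u ^ 2 + 1 - u * 2" "(u + 1) ^ 2 = u ^ 2 + 1 - u * (-2)"
    by (simp_all add: algebra_simps power2_eq_square)
  ultimately have "(u - 1) ^ 2 = 0 \<or> (u + 1) ^ 2 = 0" by auto
  then show ?thesis by (auto simp: eq_neg_iff_add_eq_0)
qed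

text \<open>The vertex may come from any field of characteristic 5: that it lies in the subfield with \<open>5^(2^j)\<close>
  elements is part of the conclusion.\<close>

lemma obstructed_level:
  assumes c: "CHAR('a::field) = 5"
  shows "(\<theta> ^^ (2 + 2 * j)) (Some T) = Some (0::'a) \<Longrightarrow> obstructed (5 ^ 2 ^ j) T"
proof (induction j arbitrary: T)
  case 0
  have m4: "(2::'a) ^ 2 = -1" using five_eq_0[OF c] by (simp add: eq_neg_iff_add_eq_0)
  have "T = 1 \<or> T = -1" using theta_pow2_eq_zero[OF c] 0 by simp
  then show ?case using m4 by (auto simp: obstructed_def)
next
  case (Suc j)
  have "(\<theta> ^^ Suc (Suc (2 + 2 * j))) (Some T) = Some 0" using Suc.prems by simp
  then obtain W0: "T \<noteq> 0" "(\<theta> ^^ Suc (2 + 2 * j)) (Some (T + inverse T)) = Some 0"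
    by (rule theta_pow_Suc_SomeE)
  obtain S0: "T + inverse T \<noteq> 0"
    "(\<theta> ^^ (2 + 2 * j)) (Some (T + inverse T + inverse (T + inverse T))) = Some 0"
    by (rule theta_pow_Suc_SomeE[OF W0(2)])
  have "obstructed ((5 ^ 2 ^ j) ^ 2) T"
    by (rule obstructed_double[OF c refl _ Suc.IH[OF S0(2)] S0(1) refl W0(1) refl]) simp
  then show ?case by (simp add: mult.commute flip: power_mult)
qed

text \<open>\<open>T\<^sup>2 + 1\<close> and \<open>2 T\<close> are nonsquares in a subfield over which the whole field has degree
  \<open>2^(l - j) m\<close>, and this degree is even exactly for \<open>j < l\<close>.\<close>

lemma infty_tree_odd_level:
  fixes T :: "'a::{field,finite}"
  assumes q: "CARD('a) = 5 ^ (2 ^ l * m)" "odd m" and c: "CHAR('a) = 5"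
    and T: "(\<theta> ^^ (2 + 2 * j)) (Some T) = Some 0" "j \<le> l"
  shows "is_square (T ^ 2 + 1) \<longleftrightarrow> j < l" "is_square (2 * T) \<longleftrightarrow> j < l"
proof -
  have "(2::nat) ^ l = 2 ^ j * 2 ^ (l - j)" using T(2) by (simp flip: power_add)
  then have q': "CARD('a) = (5 ^ 2 ^ j) ^ (2 ^ (l - j) * m)"
    unfolding q(1) by (simp add: mult.assoc flip: power_mult)
  have ev: "even (2 ^ (l - j) * m) \<longleftrightarrow> j < l" using q(2) T(2) by auto
  have ob: "obstructed (5 ^ 2 ^ j) T" by (rule obstructed_level[OF c T(1)])
  have "(\<theta> ^^ 2) (Some T) \<noteq> None" using theta_pow_None_mono[of 2 "Some T" "2 + 2 * j"] T(1) by auto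
  note nz = nonzero_if_theta_pow2_finite[OF this] two_neq_0[OF c]
  show "is_square (T ^ 2 + 1) \<longleftrightarrow> j < l"
    using is_square_iff_even_degree[OF _ q', of "T ^ 2 + 1"] ob nz ev by (simp add: obstructed_def)
  show "is_square (2 * T) \<longleftrightarrow> j < l"
    using is_square_iff_even_degree[OF _ q', of "2 * T"] ob nz ev by (simp add: obstructed_def)
qed

lemma infty_tree_even_level:
  fixes S :: "'a::{field,finite}"
  assumes q: "CARD('a) = 5 ^ (2 ^ l * m)" and c: "CHAR('a) = 5"
    and S: "(\<theta> ^^ (3 + 2 * j)) (Some S) = Some 0" "j < l"
  shows "is_square (S ^ 2 + 1)" "is_square S"
proof -
  have "(2::nat) ^ l = 2 ^ Suc j * 2 ^ (l - Suc j)" using S(2) by (simp flip: power_add power_Suc)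
  moreover have e: "((5::nat) ^ 2 ^ j) ^ 2 = 5 ^ (2 ^ Suc j)" by (simp add: mult.commute flip: power_mult)
  ultimately have q': "CARD('a) = ((5 ^ 2 ^ j) ^ 2) ^ (2 ^ (l - Suc j) * m)"
    unfolding q(1) by (simp add: mult.assoc flip: power_mult)
  have "(\<theta> ^^ Suc (2 + 2 * j)) (Some S) = Some 0" using S(1) by (simp add: numeral_3_eq_3)
  then obtain S0: "S \<noteq> 0" "(\<theta> ^^ (2 + 2 * j)) (Some (S + inverse S)) = Some 0"
    by (rule theta_pow_Suc_SomeE)
  have ob: "obstructed (5 ^ 2 ^ j) (S + inverse S)" by (rule obstructed_level[OF c S0(2)])
  have "(\<theta> ^^ 2) (Some S) \<noteq> None" using theta_pow_None_mono[of 2 "Some S" "3 + 2 * j"] S(1) by auto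
  note nz = nonzero_if_theta_pow2_finite[OF this]
  have d: "(S ^ 2 + 1) ^ (((5 ^ 2 ^ j) ^ 2 - 1) div 2) = 1" "S ^ (((5 ^ 2 ^ j) ^ 2 - 1) div 2) = 1"
    using discriminant_of_preimage[OF c refl, of "2 ^ j" "S + inverse S" S] ob S0(1)
    by (simp_all add: obstructed_def)
  show "is_square (S ^ 2 + 1)" by (rule is_square_if_power_half_1[OF _ q' nz(2) d(1)]) simp
  show "is_square S" by (rule is_square_if_power_half_1[OF _ q' nz(1) d(2)]) simp
qed

lemma infty_tree_branching:
  fixes b :: "'a::{field,finite}"
  assumes q: "CARD('a) = 5 ^ (2 ^ l * m)" "odd m" and c: "CHAR('a) = 5"
    and b: "(\<theta> ^^ i) (Some b) = Some 0" "2 \<le> i" "i \<le> 2 + 2 * l"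
  shows "is_square (b ^ 2 + 1) \<longleftrightarrow> i < 2 + 2 * l"
    and "l > 0 \<Longrightarrow> is_square b \<longleftrightarrow> i < 2 + 2 * l"
proof -
  have "(is_square (b ^ 2 + 1) \<longleftrightarrow> i < 2 + 2 * l) \<and> (l > 0 \<longrightarrow> (is_square b \<longleftrightarrow> i < 2 + 2 * l))"
  proof (cases "even i")
    case True
    then obtain j where j: "i = 2 + 2 * j" using b(2) by (metis dvdE le_iff_add dvd_add_right_iff dvd_refl)
    have sq2: "is_square (2::'a)" if "l > 0"
    proof (rule iffD2[OF is_square_iff_even_degree[OF _ q(1) two_neq_0[OF c] _ two_neq_0[OF c]]])
      show "even (2 ^ l * m)" using that by simp
      show "(2::'a) ^ ((5 - 1) div 2) = -1" using five_eq_0[OF c] by (simp add: eq_neg_iff_add_eq_0)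
    qed simp
    show ?thesis
      using infty_tree_odd_level[OF q c, of j b] b j is_square_mult_iff[OF sq2 two_neq_0[OF c], of b]
      by auto
  next
    case False
    then obtain j where "i = 2 * j + 1" by (elim oddE)
    moreover from this b(2) obtain j' where "j = Suc j'" by (cases j) auto
    ultimately have j: "i = 3 + 2 * j'" "j' < l" using b(3) by auto
    show ?thesis using infty_tree_even_level[OF q(1) c, of j' b] b j by auto
  qed
  then show "is_square (b ^ 2 + 1) \<longleftrightarrow> i < 2 + 2 * l"
    and "l > 0 \<Longrightarrow> is_square b \<longleftrightarrow> i < 2 + 2 * l" by auto
qed

text \<open>The number \<open>d\<close> is the depth of the tree formed at infinity by the points that come from the curve over
  the given field. For \<open>l = 0\<close> it is one less than the depth of the full tree, because then 1 and -1
  are not abscissas of rational points.\<close>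

lemma infty_tree_square_iff:
  fixes b :: "'a::{field,finite}"
  assumes q: "CARD('a) = 5 ^ (2 ^ l * m)" "odd m" and c: "CHAR('a) = 5"
    and b: "(\<theta> ^^ i) (Some b) = Some 0" "i < d" and d: "d = (if l = 0 then 2 else 3 + 2 * l)"
  shows "is_square b \<longleftrightarrow> Suc i < d"
proof -
  consider "i = 0" | "i = 1" | "i \<ge> 2" by linarith
  then show ?thesis
  proof cases
    case 1
    then show ?thesis using b is_nth_power_nth_power[of 2 0] by (auto simp: d)
  next
    case 2
    then have b2: "b ^ 2 = -1" using b(1) theta_eq_zero_iff[of b] by simp
    then have "b \<noteq> 0" using zero_neq_neg_one by fastforce
    then have "is_square b \<longleftrightarrow> even (2 ^ l * m)"
      using is_square_iff_even_degree[OF _ q(1), of b] two_neq_0[OF c] b2 by simp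
    then show ?thesis using 2 q(2) by (auto simp: d)
  next
    case 3
    then have "l > 0" using b(2) d by (auto split: if_splits)
    then show ?thesis using infty_tree_branching(2)[OF q c b(1) 3] b(2) d by auto
  qed
qed

section \<open>Comparison of the other trees with the tree at infinity\<close>

text \<open>The abscissa of the third point on the line through \<open>(a, y)\<close> and \<open>(b, z)\<close> is
  \<open>(a z - b y)\<^sup>2 / (a b (a - b)\<^sup>2)\<close>; changing the sign of \<open>z\<close> gives that of the difference, whose
  numerator is \<open>L\<close>. The endomorphism \<open>(a, y) \<mapsto> (a + 1/a, y (a\<^sup>2 - 1) / a\<^sup>2)\<close> is additive, so it carries
  collinear points to collinear points, and this lemma is the resulting identity for abscissas. It
  comes down to
  \<open>(a z - b y)\<^sup>2 (1 - a b)\<^sup>2 + (a z + b y)\<^sup>2 (a - b)\<^sup>2 = a b (y (b\<^sup>2 - 1) - z (a\<^sup>2 - 1))\<^sup>2\<close>.\<close>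

lemma chord_theta:
  fixes a b y z c :: "'a::field"
  assumes E: "y ^ 2 = a ^ 3 + a" "z ^ 2 = b ^ 3 + b"
    and nz: "a \<noteq> 0" "b \<noteq> 0" "a \<noteq> b" "a * b \<noteq> 1"
    and c: "c * (a * b * (a - b) ^ 2) = (a * z - b * y) ^ 2"
    and AB: "A = a + inverse a" "B = b + inverse b"
    and YZ: "Y = y * (a ^ 2 - 1) / a ^ 2" "Z = z * (b ^ 2 - 1) / b ^ 2"
  shows "c \<noteq> 0" and "(c + inverse c) * (A * B * (A - B) ^ 2) = (A * Z - B * Y) ^ 2"
proof -
  define M where "M = (a * z - b * y) ^ 2"
  define L where "L = (a * z + b * y) ^ 2"
  define R where "R = y * (b ^ 2 - 1) - z * (a ^ 2 - 1)"
  have prod_LM: "M * L = (a * b * (a - b) * (1 - a * b)) ^ 2"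
    unfolding M_def L_def using E by algebra
  have sum_LM: "M * (1 - a * b) ^ 2 + L * (a - b) ^ 2 = a * b * R ^ 2"
    unfolding M_def L_def R_def using E by algebra
  have nz': "a - b \<noteq> 0" "1 - a * b \<noteq> 0" using nz by auto
  then have M0: "M \<noteq> 0" using prod_LM nz by auto
  then show c0: "c \<noteq> 0" using c M_def by auto
  have "inverse c * (a * b * (1 - a * b) ^ 2) = L"
  proof -
    have "M * (a * b * (1 - a * b) ^ 2) = c * (M * L)"
      unfolding prod_LM using c unfolding M_def by algebra
    then have "a * b * (1 - a * b) ^ 2 = c * L" using M0 by (simp add: mult.left_commute)
    then show ?thesis using c0 by simp
  qed
  moreover have "(c + inverse c) * (a * b * (a - b) ^ 2 * (1 - a * b) ^ 2)
      = (c * (a * b * (a - b) ^ 2)) * (1 - a * b) ^ 2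
        + (inverse c * (a * b * (1 - a * b) ^ 2)) * (a - b) ^ 2" by algebra
  ultimately have "(c + inverse c) * (a * b * (a - b) ^ 2 * (1 - a * b) ^ 2) = a * b * R ^ 2"
    using sum_LM c M_def by simp
  then have cR: "(c + inverse c) * ((a - b) * (1 - a * b)) ^ 2 = R ^ 2"
    using nz by (simp add: power_mult_distrib mult.assoc mult.left_commute)
  have A: "A * a ^ 2 = y ^ 2" "B * b ^ 2 = z ^ 2"
  proof -
    have "A * a = a ^ 2 + 1" "B * b = b ^ 2 + 1" using AB nz by (simp_all add: field_simps power2_eq_square)
    then show "A * a ^ 2 = y ^ 2" "B * b ^ 2 = z ^ 2" using E by algebra+
  qed
  have Y: "Y * a ^ 2 = y * (a ^ 2 - 1)" "Z * b ^ 2 = z * (b ^ 2 - 1)" using YZ nz by simp_all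
  have D: "(A - B) * (a * b) = - ((a - b) * (1 - a * b))"
    unfolding AB using nz by (simp add: field_simps)
  have "(c + inverse c) * (A * B * (A - B) ^ 2) * (a * b) ^ 4
      = (c + inverse c) * ((A * a ^ 2) * (B * b ^ 2) * ((A - B) * (a * b)) ^ 2)" by algebra
  also have "\<dots> = y ^ 2 * z ^ 2 * R ^ 2" unfolding A D cR[symmetric] by algebra
  also have "\<dots> = ((A * a ^ 2) * (Z * b ^ 2) - (B * b ^ 2) * (Y * a ^ 2)) ^ 2"
    unfolding A Y R_def by algebra
  also have "\<dots> = (A * Z - B * Y) ^ 2 * (a * b) ^ 4" by algebra
  finally show "(c + inverse c) * (A * B * (A - B) ^ 2) = (A * Z - B * Y) ^ 2"
    using nz by simp
qed

text \<open>This is where the characteristic enters: in general the map leads to the curve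
  \<open>Y\<^sup>2 = X\<^sup>3 - 4 X\<close>, which is the original one because \<open>-4 = 1\<close>.\<close>

lemma theta_on_curve:
  fixes a y :: "'a::field"
  assumes c: "CHAR('a) = 5" and E: "y ^ 2 = a ^ 3 + a" and a: "a \<noteq> 0"
  shows "(y * (a ^ 2 - 1) / a ^ 2) ^ 2 = (a + inverse a) ^ 3 + (a + inverse a)"
proof -
  define A where "A = a + inverse a"
  have "A ^ 3 + A = A * (A ^ 2 - 4) + 5 * A" by (simp add: power3_eq_cube power2_eq_square algebra_simps)
  then have "A ^ 3 + A = A * (A ^ 2 - 4)" using five_eq_0[OF c] by simp
  moreover have "A ^ 2 - 4 = ((a ^ 2 - 1) / a) ^ 2"
    unfolding A_def using a by (simp add: field_simps power2_eq_square)
  moreover have "y ^ 2 / a ^ 2 = A"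
    unfolding A_def E using a by (simp add: field_simps power2_eq_square power3_eq_cube)
  moreover have "(y * (a ^ 2 - 1) / a ^ 2) ^ 2 = y ^ 2 / a ^ 2 * ((a ^ 2 - 1) / a) ^ 2"
    by (simp add: power_divide power_mult_distrib power2_eq_square)
  ultimately show ?thesis unfolding A_def[symmetric] by (simp only:)
qed

text \<open>If the orbits of \<open>a\<close> and \<open>b\<close> merge after exactly \<open>k + 1\<close> steps, then suitable points above \<open>a\<close> and
  \<open>b\<close> differ by a point whose abscissa \<open>c\<close> reaches 0 after \<open>k\<close> steps. In the last step before merging
  the two abscissas are inverse to each other, and one of the two lines through points above them
  passes through the origin. Which of the two lines has to be taken is decided there, and the choice
  of the sign of \<open>z'\<close> is pulled back along the orbits from that step.\<close>

lemma chord_pullback: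
  fixes a b y z :: "'a::field"
  assumes c: "CHAR('a) = 5"
  shows "\<lbrakk>y ^ 2 = a ^ 3 + a; z ^ 2 = b ^ 3 + b; a \<noteq> 0; b \<noteq> 0;
    (\<theta> ^^ Suc k) (Some a) = (\<theta> ^^ Suc k) (Some b); (\<theta> ^^ Suc k) (Some a) \<noteq> None;
    (\<theta> ^^ k) (Some a) \<noteq> (\<theta> ^^ k) (Some b)\<rbrakk> \<Longrightarrow>
    \<exists>c z'. z' ^ 2 = z ^ 2 \<and> (\<theta> ^^ k) (Some c) = Some 0 \<and>
      c * (a * b * (a - b) ^ 2) = (a * z' - b * y) ^ 2"
proof (induction k arbitrary: a b y z)
  case 0
  then have ab: "a + inverse a = b + inverse b" "a \<noteq> b" by auto
  have "(a - b) * (a * b - 1) = a * b * ((a + inverse a) - (b + inverse b))"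
    using 0(3,4) by (simp add: field_simps)
  then have ab1: "a * b = 1" using ab by simp
  have "(a * z) ^ 2 - (b * y) ^ 2 = a * b * (a - b) * (1 - a * b)" using 0(1,2) by algebra
  then have "(a * z) ^ 2 = (b * y) ^ 2" using ab1 by simp
  then have "a * z = b * y \<or> a * z = - (b * y)" by (simp only: power2_eq_iff)
  then have "a * z = b * y \<or> a * (- z) = b * y" by (metis minus_minus mult_minus_right)
  then have "\<exists>z'. z' ^ 2 = z ^ 2 \<and> a * z' = b * y" by (metis power2_minus)
  then obtain z' where "z' ^ 2 = z ^ 2" "a * z' = b * y" by blast
  then show ?case by (intro exI[of _ 0] exI[of _ z']) simp
next
  case (Suc k)
  define A B Y Z where AB: "A = a + inverse a" "B = b + inverse b"
    and YZ: "Y = y * (a ^ 2 - 1) / a ^ 2" "Z = z * (b ^ 2 - 1) / b ^ 2"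
  have th: "\<theta> (Some a) = Some A" "\<theta> (Some b) = Some B" using Suc.prems(3,4) AB by simp_all
  have it: "(\<theta> ^^ Suc k) (Some A) = (\<theta> ^^ Suc k) (Some B)" "(\<theta> ^^ Suc k) (Some A) \<noteq> None"
    "(\<theta> ^^ k) (Some A) \<noteq> (\<theta> ^^ k) (Some B)"
    using Suc.prems(5-7) unfolding theta_pow_Suc th by auto
  have nz: "A \<noteq> 0" "B \<noteq> 0" "A \<noteq> B"
    using it by (auto simp: theta_pow_Suc simp del: funpow.simps)
  have "a \<noteq> b" using nz(3) AB by auto
  moreover have "a * b \<noteq> 1"
  proof
    assume "a * b = 1"
    then have "b = inverse a" by (simp add: inverse_unique)
    then show False using nz(3) AB by simp
  qed
  ultimately have nz': "a \<noteq> b" "a * b \<noteq> 1" by auto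
  have EA: "Y ^ 2 = A ^ 3 + A" "Z ^ 2 = B ^ 3 + B"
    unfolding YZ AB using theta_on_curve[OF c] Suc.prems(1-4) by auto
  obtain c' Z' where Z': "Z' ^ 2 = Z ^ 2" and c': "(\<theta> ^^ k) (Some c') = Some 0"
    "c' * (A * B * (A - B) ^ 2) = (A * Z' - B * Y) ^ 2"
    using Suc.IH[OF EA nz(1,2) it] by blast
  obtain z' where z': "z' ^ 2 = z ^ 2" "Z' = z' * (b ^ 2 - 1) / b ^ 2"
  proof (cases "Z' = Z")
    case True
    then show ?thesis using that[of z] YZ(2) by simp
  next
    case False
    then have "Z' = - Z" using Z' by (simp add: power2_eq_iff)
    then show ?thesis using that[of "- z"] YZ(2) by simp
  qed
  define c0 where "c0 = (a * z' - b * y) ^ 2 / (a * b * (a - b) ^ 2)"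
  have c0: "c0 * (a * b * (a - b) ^ 2) = (a * z' - b * y) ^ 2"
    unfolding c0_def using Suc.prems(3,4) nz' by simp
  have Ez': "z' ^ 2 = b ^ 3 + b" using z'(1) Suc.prems(2) by simp
  note ch = chord_theta[OF Suc.prems(1) Ez' Suc.prems(3,4) nz' c0 AB YZ(1) z'(2)]
  have "A * B * (A - B) ^ 2 \<noteq> 0" using nz by simp
  then have "c0 + inverse c0 = c'"
    using ch(2) c'(2) mult_right_cancel[of "A * B * (A - B) ^ 2" "c0 + inverse c0" c'] by metis
  then have "(\<theta> ^^ Suc k) (Some c0) = Some 0"
    using ch(1) c'(1) by (simp add: theta_pow_Suc del: funpow.simps)
  then show ?case using z'(1) c0 by blast
qed

lemma A_set_Some_iff: "Some u \<in> A_set \<longleftrightarrow> (\<exists>y. y ^ 2 = u ^ 3 + u)"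
  by (auto simp: A_set_def E_affine_def)

lemma A_set_square_iff:
  assumes "Some v \<in> A_set" "v \<noteq> 0" "v ^ 2 + 1 \<noteq> 0"
  shows "is_square (v ^ 2 + 1) \<longleftrightarrow> is_square v"
proof -
  have e: "v ^ 3 + v = (v ^ 2 + 1) * v" by (simp add: power2_eq_square power3_eq_cube algebra_simps)
  have "is_square ((v ^ 2 + 1) * v)"
    using assms(1) unfolding A_set_Some_iff e is_nth_power_def by (metis)
  then show ?thesis by (rule is_square_iff_of_mult) (use assms in auto)
qed

text \<open>A preimage makes \<open>v\<^sup>2 + 1\<close> a square, and on the curve \<open>v (v\<^sup>2 + 1)\<close> is one.\<close>

lemma A_set_image_square:
  fixes u v :: "'a::field"
  assumes c: "CHAR('a) = 5" and "Some v \<in> A_set" "v \<noteq> 0" "v ^ 2 + 1 \<noteq> 0" "\<theta> (Some u) = Some v"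
  shows "is_square v"
proof -
  have "is_square (v ^ 2 + 1)"
    using preimages_Some_iff[OF c, of u v] assms(5) is_nth_power_nth_power by metis
  then show ?thesis using A_set_square_iff[OF assms(2-4)] by simp
qed

text \<open>For \<open>v = u + 1/u\<close> one has \<open>u\<^sup>3 + u = u\<^sup>2 v\<close>, and \<open>v\<close> is a square since it has a preimage.\<close>

lemma A_set_backward:
  fixes u :: "'a::field"
  assumes c: "CHAR('a) = 5"
  shows "\<forall>m. (\<theta> ^^ m) (Some u) \<noteq> None \<Longrightarrow> (\<theta> ^^ k) (Some u) \<in> A_set \<Longrightarrow> Some u \<in> A_set"
proof (induction k arbitrary: u)
  case 0
  then show ?case by simp
next
  case (Suc k)
  have u0: "u \<noteq> 0" using Suc.prems(1)[rule_format, of 1] by auto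
  define v where "v = u + inverse u"
  have th: "\<theta> (Some u) = Some v" using u0 v_def by simp
  have fin: "\<forall>m. (\<theta> ^^ m) (Some v) \<noteq> None" using Suc.prems(1) th by (metis theta_pow_Suc)
  have "(\<theta> ^^ k) (Some v) \<in> A_set" using Suc.prems(2) th by (metis theta_pow_Suc)
  then have v: "Some v \<in> A_set" using Suc.IH fin by blast
  note nz = nonzero_if_theta_pow2_finite[OF fin[rule_format]]
  have "is_square v" by (rule A_set_image_square[OF c v nz th])
  then have "is_square (u ^ 2 * v)"
    using u0 is_square_mult_iff[OF is_nth_power_nth_power[of 2 u], of v] by simp
  moreover have "u ^ 2 * v = u ^ 3 + u"
    unfolding v_def using u0 by (simp add: field_simps power2_eq_square power3_eq_cube)
  ultimately show ?case unfolding A_set_Some_iff is_nth_power_def by metis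
qed

lemma V_A_orbit:
  assumes "x \<in> V_A"
  shows "periodic x" "(\<theta> ^^ i) x \<in> A_set"
proof -
  obtain k where k: "k > 0" "(\<theta> ^^ k) x = x" "\<forall>i<k. (\<theta> ^^ i) x \<in> A_set"
    using assms unfolding V_A_def by blast
  show "periodic x" using k unfolding periodic_def by blast
  have "(\<theta> ^^ (i mod k)) x \<in> A_set" using k by simp
  then show "(\<theta> ^^ i) x \<in> A_set" using funpow_mod_eq[OF k(2)] by simp
qed

lemma theta_pow_finite_if_periodic:
  assumes "periodic x" "x \<noteq> None" "(\<theta> ^^ k) p = x"
  shows "(\<theta> ^^ m) p \<noteq> None"
proof
  assume "(\<theta> ^^ m) p = None"
  then have "(\<theta> ^^ (m + k)) p = None" by (rule theta_pow_None_mono) simp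
  then have "(\<theta> ^^ m) x = None" using assms(3) by (simp add: funpow_add)
  then show False using periodic_reaching_None[OF assms(1)] assms(2) by blast
qed

text \<open>Going back \<open>k\<close> steps on a cycle of length \<open>t\<close> is the same as going forward \<open>k (t - 1)\<close> steps.\<close>

lemma periodic_ancestor:
  assumes "x \<in> V_A"
  obtains p where "p \<in> V_A" "(\<theta> ^^ k) p = x"
proof -
  obtain t where t: "t > 0" "(\<theta> ^^ t) x = x" "\<forall>i<t. (\<theta> ^^ i) x \<in> A_set"
    using assms unfolding V_A_def by blast
  define p where "p = (\<theta> ^^ (k * (t - 1))) x"
  have "k + k * (t - 1) = k * t" using t(1) by (cases t) auto
  then have kp: "(\<theta> ^^ k) p = x"
    unfolding p_def using theta_pow_period[OF t(2), of k] by (metis comp_apply funpow_add)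
  have "(\<theta> ^^ t) p = p" unfolding p_def using t(2) by (metis add.commute comp_apply funpow_add)
  moreover have "(\<theta> ^^ i) p \<in> A_set" for i
    unfolding p_def using V_A_orbit(2)[OF assms, of "i + k * (t - 1)"] by (simp add: funpow_add)
  ultimately have "p \<in> V_A" using t(1) unfolding V_A_def by blast
  then show thesis using that kp by blast
qed

text \<open>Let \<open>b\<close> be the periodic point with the same image as \<open>a\<close> after \<open>k + 1\<close> steps. It is a
  square, and so is \<open>a b d\<close> by collinearity; hence \<open>a\<close> and \<open>d\<close> are squares together. For \<open>k = 0\<close> the
  point \<open>d\<close> is 0, since \<open>a\<close> and \<open>b\<close> are inverse to each other; then \<open>a\<close> is a square like \<open>b\<close>.\<close>

lemma tree_square_transfer:
  fixes x :: "'a::field proj_line"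
  assumes c: "CHAR('a) = 5" and x: "x \<in> V_A" "x \<noteq> None" and P: "P \<in> level x (Suc k)"
  obtains a d :: 'a where "P = Some a" "a ^ 2 + 1 \<noteq> 0" "is_square (a ^ 2 + 1) \<longleftrightarrow> is_square d"
    "(\<theta> ^^ k) (Some d) = Some 0"
proof -
  note per = V_A_orbit(1)[OF x(1)]
  have Px: "(\<theta> ^^ Suc k) P = x" by (rule level_root_pow[OF P])
  note finP = theta_pow_finite_if_periodic[OF per x(2) Px]
  obtain a where a: "P = Some a" using finP[of 0] by auto
  note nza = nonzero_if_theta_pow2_finite[OF finP[of 2, unfolded a]]
  have aA: "Some a \<in> A_set"
    using A_set_backward[OF c, of a "Suc k"] finP Px V_A_orbit(2)[OF x(1), of 0] by (simp add: a)
  obtain p where p: "p \<in> V_A" "(\<theta> ^^ Suc k) p = x" using periodic_ancestor[OF x(1)] by blast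
  note finp = theta_pow_finite_if_periodic[OF per x(2) p(2)]
  obtain b where b: "p = Some b" using finp[of 0] by auto
  note nzb = nonzero_if_theta_pow2_finite[OF finp[of 2, unfolded b]]
  have bA: "Some b \<in> A_set" using V_A_orbit(2)[OF p(1), of 0] b by simp
  obtain p' where p': "p' \<in> V_A" "(\<theta> ^^ 1) p' = p" using periodic_ancestor[OF p(1)] by blast
  obtain b' where b': "p' = Some b'" using p'(2) b by (cases p') auto
  have bsq: "is_square b" by (rule A_set_image_square[OF c bA nzb]) (use p'(2) b b' in simp)
  obtain y z where yz: "y ^ 2 = a ^ 3 + a" "z ^ 2 = b ^ 3 + b"
    using aA bA unfolding A_set_Some_iff by blast
  have ne: "(\<theta> ^^ k) (Some a) \<noteq> (\<theta> ^^ k) (Some b)"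
    using not_periodic_level[OF P, of k] periodic_theta_pow[OF V_A_orbit(1)[OF p(1)], of k]
    unfolding a b by auto
  obtain d z' where d: "(\<theta> ^^ k) (Some d) = Some 0"
    "d * (a * b * (a - b) ^ 2) = (a * z' - b * y) ^ 2"
    using chord_pullback[OF c yz nza(1) nzb(1), of k] Px p(2) ne x(2) unfolding a b by auto
  have asq: "is_square (a ^ 2 + 1) \<longleftrightarrow> is_square a" by (rule A_set_square_iff[OF aA nza])
  have "is_square a \<longleftrightarrow> is_square d"
  proof (cases "d = 0")
    case True
    then have k0: "k = 0" using d(1) by (cases k) (simp_all add: theta_pow_Suc del: funpow.simps)
    have e: "a + inverse a = b + inverse b" "a \<noteq> b"
      using Px p(2) ne nza(1) nzb(1) unfolding a b k0 by auto
    have "(a - b) * (a * b - 1) = a * b * ((a + inverse a) - (b + inverse b))"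
      using nza nzb by (simp add: field_simps)
    then have "b * a = 1" using e by (simp add: mult.commute)
    then have "is_square (b * a)" using is_nth_power_nth_power[of 2 "1::'a"] by simp
    then show ?thesis
      using True is_square_mult_iff[OF bsq nzb(1), of a] is_nth_power_nth_power[of 2 "0::'a"] by simp
  next
    case False
    have "a \<noteq> b" using ne by auto
    then have ab: "(a - b) ^ 2 \<noteq> 0" by simp
    have "is_square ((a - b) ^ 2 * (b * (a * d)))"
      using d(2) is_nth_power_nth_power[of 2 "a * z' - b * y"] by (simp add: mult_ac)
    then have "is_square (a * d)"
      using is_square_mult_iff[OF is_nth_power_nth_power ab] is_square_mult_iff[OF bsq nzb(1)] by simp
    then show ?thesis by (rule is_square_iff_of_mult) (use False nza in simp)
  qed
  then have "is_square (a ^ 2 + 1) \<longleftrightarrow> is_square d" using asq by simp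
  then show thesis using that a nza(2) d(1) by blast
qed

section \<open>Shape of the trees\<close>

lemma card_children_Some:
  fixes b :: "'a::field"
  assumes c: "CHAR('a) = 5" and z: "Some b \<in> level x k" "k > 0"
  shows "card (children x k (Some b)) =
    (if b ^ 2 + 1 = 0 then 1 else if is_square (b ^ 2 + 1) then 2 else 0)"
  unfolding children_eq[OF z] by (rule card_preimages_Some[OF c])

text \<open>The two preimages \<open>u\<close> and \<open>1/u\<close> of a finite periodic point are distinct, and since \<^term>\<open>\<theta>\<close> is injective on
  periodic points exactly one of them is periodic.\<close>

lemma affine_tree_root:
  fixes x :: "'a::field proj_line"
  assumes c: "CHAR('a) = 5" and x: "x \<in> V_A" "x \<noteq> None"
  shows "card (children x 0 x) = 1"
proof -
  obtain p where p: "p \<in> V_A" "(\<theta> ^^ 1) p = x" using periodic_ancestor[OF x(1)] by blast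
  note fin = theta_pow_finite_if_periodic[OF V_A_orbit(1)[OF x(1)] x(2) p(2)]
  obtain u where u: "p = Some u" using fin[of 0] by auto
  have u0: "u \<noteq> 0" using fin[of 1] u by auto
  have per: "periodic (Some u)" using V_A_orbit(1)[OF p(1)] u by simp
  have xu: "x = Some (u + inverse u)" using p(2) u u0 by simp
  have ne: "inverse u \<noteq> u"
  proof
    assume "inverse u = u"
    then have "u * u = 1" using u0 by (metis right_inverse)
    then have "(u + inverse u) ^ 2 + 1 = 5"
      using \<open>inverse u = u\<close> by (simp add: power2_eq_square algebra_simps)
    moreover have "(\<theta> ^^ 2) x \<noteq> None" using theta_pow_finite_if_periodic[OF V_A_orbit(1)[OF x(1)] x(2), of 0 x 2] by simp
    ultimately show False using nonzero_if_theta_pow2_finite(2) xu five_eq_0[OF c] by metis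
  qed
  have "\<not> periodic (Some (inverse u))"
    using theta_inj_periodic[OF per, of "Some (inverse u)"] ne u0 by (auto simp: add.commute)
  moreover have "w = Some u \<or> w = Some (inverse u)" if w: "\<theta> w = x" for w
  proof -
    obtain v where v: "w = Some v" using w unfolding xu by (cases w) auto
    have v0: "v \<noteq> 0" using w unfolding xu v by auto
    have "(v - u) * (v - inverse u) = v * ((v + inverse v) - (u + inverse u))"
      using u0 v0 by (simp add: algebra_simps)
    also have "\<dots> = 0" using w v0 unfolding xu v by simp
    finally show ?thesis using v by auto
  qed
  moreover have "\<theta> (Some (inverse u)) = x" using xu u0 by (simp add: add.commute)
  ultimately have "children x 0 x = {Some (inverse u)}" unfolding children_root using per by blast
  then show ?thesis by simp
qed

lemma affine_tree_branching:
  fixes x :: "'a::{field,finite} proj_line"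
  assumes q: "CARD('a) = 5 ^ (2 ^ l * m)" "odd m" and c: "CHAR('a) = 5"
    and x: "x \<in> V_A" "x \<noteq> None" and d: "d = (if l = 0 then 2 else 3 + 2 * l)"
    and z: "z \<in> level x k" "0 < k" "k \<le> d"
  shows "card (children x k z) = (if k < d then 2 else 0)"
proof -
  obtain i where i: "k = Suc i" using z(2) by (cases k) auto
  obtain a t :: 'a where a: "z = Some a" "a ^ 2 + 1 \<noteq> 0" "is_square (a ^ 2 + 1) \<longleftrightarrow> is_square t"
    "(\<theta> ^^ i) (Some t) = Some 0"
    by (rule tree_square_transfer[OF c x z(1)[unfolded i]])
  have "is_square t \<longleftrightarrow> k < d"
    unfolding i by (rule infty_tree_square_iff[OF q c a(4) _ d]) (use z(3) i in simp)
  then show ?thesis using card_children_Some[OF c z(1)[unfolded a(1)] z(2)] a by simp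
qed

lemma infty_tree_root: "children None 0 None = {Some (0::'a::field)}"
proof -
  have "\<not> periodic (Some (0::'a))"
    using periodic_reaching_None[of "Some (0::'a)" 1] by auto
  then show ?thesis unfolding children_root by (auto simp: theta_eq_None_iff)
qed

lemma infty_tree_branching_card:
  fixes z :: "'a::{field,finite} proj_line"
  assumes q: "CARD('a) = 5 ^ (2 ^ l * m)" "odd m" and c: "CHAR('a) = 5"
    and z: "z \<in> level None k" "0 < k" "k \<le> 3 + 2 * l"
  shows "card (children None k z) = (if k = 2 then 1 else if k < 3 + 2 * l then 2 else 0)"
proof -
  obtain i where i: "k = Suc i" using z(2) by (cases k) auto
  have zi: "(\<theta> ^^ i) z = Some 0" using z(1) unfolding i level_infty by simp
  obtain b where b: "z = Some b" using zi by (cases z) auto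
  note card = card_children_Some[OF c z(1)[unfolded b] z(2)]
  consider "i = 0" | "i = 1" | "i \<ge> 2" by linarith
  then show ?thesis
  proof cases
    case 1
    then have "b = 0" using zi b by simp
    then show ?thesis using card is_nth_power_nth_power[of 2 "1::'a"] b i 1 by simp
  next
    case 2
    then have "b ^ 2 = -1" using zi b theta_eq_zero_iff[of b] by simp
    then show ?thesis using card b i 2 by simp
  next
    case 3
    have "(\<theta> ^^ 2) (Some b) \<noteq> None" using theta_pow_None_mono[of 2 "Some b" i] 3 zi b by auto
    then have "b ^ 2 + 1 \<noteq> 0" by (rule nonzero_if_theta_pow2_finite(2))
    moreover have "is_square (b ^ 2 + 1) \<longleftrightarrow> i < 2 + 2 * l"
      by (rule infty_tree_branching(1)[OF q c zi[unfolded b] 3]) (use z(3) i in simp)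
    ultimately show ?thesis using card b i 3 by simp
  qed
qed

lemma affine_tree_shape:
  fixes x :: "'a::{field,finite} proj_line"
  assumes q: "CARD('a) = 5 ^ (2 ^ l * m)" "odd m" and c: "CHAR('a) = 5"
    and x: "x \<in> V_A" "x \<noteq> None" and d: "d = (if l = 0 then 2 else 3 + 2 * l)"
  shows "\<And>k. 0 < k \<Longrightarrow> k \<le> d \<Longrightarrow> card (level x k) = 2 ^ (k - 1)" and "has_depth x d"
proof -
  note br = affine_tree_branching[OF q c x d]
  have lev: "card (level x (Suc k)) = 2 ^ k" if "Suc k \<le> d" for k
    using that
  proof (induction k)
    case 0
    have "card (level x (Suc 0)) = 1 * card (level x 0)"
      by (rule card_level_Suc) (use affine_tree_root[OF c x] in \<open>simp add: level_def\<close>)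
    then show ?case by (simp add: level_def)
  next
    case (Suc k)
    have "card (level x (Suc (Suc k))) = 2 * card (level x (Suc k))"
      by (rule card_level_Suc) (use br Suc.prems in simp)
    then show ?case using Suc by simp
  qed
  then show lev': "card (level x k) = 2 ^ (k - 1)" if "0 < k" "k \<le> d" for k
    using that by (cases k) auto
  have d0: "d > 0" using d by simp
  show "has_depth x d"
  proof (rule has_depthI)
    show "level x d \<noteq> {}" using lev'[OF d0] by auto
    show "children x d z = {}" if "z \<in> level x d" for z
      using br[OF that d0] by simp
  qed
qed

lemma infty_tree_shape:
  assumes q: "CARD('a::{field,finite}) = 5 ^ (2 ^ l * m)" "odd m" and c: "CHAR('a) = 5"
  shows "card (level (None :: 'a proj_line) 1) = 1" "card (level (None :: 'a proj_line) 2) = 2"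
    and "\<And>k. 2 < k \<Longrightarrow> k \<le> 3 + 2 * l \<Longrightarrow> card (level (None :: 'a proj_line) k) = 2 ^ (k - 2)"
    and "has_depth (None :: 'a proj_line) (3 + 2 * l)"
proof -
  let ?L = "level (None :: 'a proj_line)"
  note br = infty_tree_branching_card[OF q c]
  have "card (?L (Suc 0)) = 1 * card (?L 0)"
    by (rule card_level_Suc) (use infty_tree_root[where 'a='a] in \<open>simp add: level_def\<close>)
  then show l1: "card (?L 1) = 1" by (simp add: level_def)
  have "card (?L (Suc 1)) = 2 * card (?L 1)" by (rule card_level_Suc) (use br in simp)
  then show l2: "card (?L 2) = 2" using l1 by (simp add: numeral_2_eq_2)
  have "card (?L (Suc 2)) = 1 * card (?L 2)" by (rule card_level_Suc) (use br in simp)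
  then have l3: "card (?L 3) = 2" using l2 by (simp add: numeral_3_eq_3 numeral_2_eq_2)
  have lev: "card (?L (3 + k)) = 2 ^ Suc k" if "3 + k \<le> 3 + 2 * l" for k
    using that
  proof (induction k)
    case 0
    then show ?case using l3 by simp
  next
    case (Suc k)
    have "card (?L (Suc (3 + k))) = 2 * card (?L (3 + k))"
      by (rule card_level_Suc) (use br Suc.prems in simp)
    then show ?case using Suc by simp
  qed
  show lev': "card (?L k) = 2 ^ (k - 2)" if k: "2 < k" "k \<le> 3 + 2 * l" for k
  proof -
    obtain i where "k = 3 + i" using k(1) by (metis Suc_leI eval_nat_numeral(3) le_Suc_ex)
    then show ?thesis using lev[of i] k(2) by simp
  qed
  show "has_depth (None :: 'a proj_line) (3 + 2 * l)"
  proof (rule has_depthI)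
    show "?L (3 + 2 * l) \<noteq> {}" using lev[of "2 * l"] by auto
    show "children None (3 + 2 * l) z = {}" if "z \<in> ?L (3 + 2 * l)" for z
      using br[OF that] by simp
  qed
qed

theorem lemma2p7:
  fixes n :: nat and x :: "'a::{field,finite} proj_line"
  assumes "n > 0" and "CARD('a) = 5 ^ n" and "x \<in> V_A"
  shows "\<exists>d. reversed_binary_tree x \<and> has_depth x d \<and>
    (x \<noteq> infty \<longrightarrow>
       (\<forall>k. 0 < k \<and> k \<le> d \<longrightarrow> card (level x k) = 2 ^ (k - 1)) \<and>
       card (children x 0 x) = 1 \<and>
       (\<forall>k z. 0 < k \<and> k < d \<and> z \<in> level x k \<longrightarrow> card (children x k z) = 2)) \<and>
    (x = infty \<longrightarrow>
       card (level x 1) = 1 \<and> card (level x 2) = 2 \<and>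
       (\<forall>k. 2 < k \<and> k \<le> d \<longrightarrow> card (level x k) = 2 ^ (k - 2)) \<and>
       card (children x 0 x) = 1 \<and>
       (\<forall>z \<in> level x 2. card (children x 2 z) = 1) \<and>
       (\<forall>k z. 0 < k \<and> k \<noteq> 2 \<and> k < d \<and> z \<in> level x k \<longrightarrow> card (children x k z) = 2)) \<and>
    (odd n \<longrightarrow> (x \<noteq> infty \<longrightarrow> d = 2) \<and> (x = infty \<longrightarrow> d = 3)) \<and>
    (even n \<longrightarrow> (\<forall>l. 2 ^ l dvd n \<and> \<not> 2 ^ Suc l dvd n \<longrightarrow> d = 3 + 2 * l))"
proof -
  have c: "CHAR('a) = 5" by (rule CHAR_eq_5[OF assms(1,2)])
  define l where "l = multiplicity 2 n"
  obtain m where n: "n = 2 ^ l * m" "odd m"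
    using multiplicity_decompose'[of n 2] assms(1) unfolding l_def by auto
  have q: "CARD('a) = 5 ^ (2 ^ l * m)" using assms(2) n(1) by simp
  have bt: "reversed_binary_tree x"
    by (rule reversed_binary_tree_periodic[OF c V_A_orbit(1)[OF assms(3)]])
  have odd: "odd n \<longleftrightarrow> l = 0" using n by auto
  have uniq: "k = l" if "2 ^ k dvd n \<and> \<not> 2 ^ Suc k dvd n" for k
    unfolding l_def using multiplicity_eqI[of 2 k n] that by simp
  show ?thesis
  proof (cases "x = None")
    case True
    show ?thesis
      using bt infty_tree_shape[OF q n(2) c] infty_tree_branching_card[OF q n(2) c] infty_tree_root[where 'a='a]
        odd uniq True
      by (intro exI[of _ "3 + 2 * l"]) auto
  next
    case False
    define d where "d = (if l = 0 then 2 else 3 + 2 * l)"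
    show ?thesis
      using bt affine_tree_shape[OF q n(2) c assms(3) False d_def] affine_tree_root[OF c assms(3) False]
        affine_tree_branching[OF q n(2) c assms(3) False d_def] odd uniq False
      by (intro exI[of _ d]) (auto simp: d_def)
  qed
qed

end
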